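(* For every $g\in\mathbb{R}^T$ we have $$\{A^*(f)\mid f\in\mathbb{R}^T \text{ is a super-reparametrization of } g\}=\{A^*(f)\mid f\in\mathbb{R}^T\}.$$
   Context: Fix a structure $(D,V,C)$: $V$ is a finite set of variables, $D$ a finite nonempty domain, $C\subseteq 2^V$ a set of non-empty subsets of $V$ (scopes). For $S\subseteq V$, $D^S$ is the set of maps $S\to D$; for an assignment $x\in D^V$, $x[S]\in D^S$ is its restriction to $S$. Tuples: $T_S=\{(S,k)\mid k\in D^S\}$ for $S\in C$ and $T=\bigcup_{S\in C}T_S$. A WCSP is a vector $f\in\mathbb{R}^T$. The map $\phi\colon D^V\to\{0,1\}^T$ is defined by $\phi_{(S,k)}(x)=1$ if $x[S]=k$ and $0$ otherwise, so the WCSP objective is $\langle f,\phi(x)\rangle=\sum_{S\in C}f_{(S,x[S])}$. A WCSP $f$ is a super-reparametrization of $g$ if $\langle f,\phi(x)\rangle\ge\langle g,\phi(x)\rangle$ for all $x\in D^V$. A tuple $t\in T_S$ is active for $f$ if $f_t=\max_{t'\in T_S}f_{t'}$; $A^*(f)\subseteq T$ is the set of all tuples active for $f$. *)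

theory Defs
  imports Complex_Main "HOL-Library.FuncSet"
begin

(* A map S -> D is an element of S \<rightarrow>\<^sub>E D, i.e. it is undefined outside S, so that equality of
   HOL functions is equality of maps; the same goes for vectors indexed by the set of tuples. *)

definition scope_tuples :: "'d set \<Rightarrow> 'v set \<Rightarrow> ('v set \<times> ('v \<Rightarrow> 'd)) set" where
  "scope_tuples D S = {(S, k) | k. k \<in> S \<rightarrow>\<^sub>E D}"

definition tuples :: "'d set \<Rightarrow> 'v set set \<Rightarrow> ('v set \<times> ('v \<Rightarrow> 'd)) set" where
  "tuples D C = (\<Union>S\<in>C. scope_tuples D S)"

definition wcsps :: "'d set \<Rightarrow> 'v set set \<Rightarrow> ('v set \<times> ('v \<Rightarrow> 'd) \<Rightarrow> real) set" where
  "wcsps D C = (tuples D C \<rightarrow>\<^sub>E UNIV)"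

definition phi :: "'d set \<Rightarrow> 'v set set \<Rightarrow> ('v \<Rightarrow> 'd) \<Rightarrow> ('v set \<times> ('v \<Rightarrow> 'd) \<Rightarrow> real)" where
  "phi D C x = (\<lambda>(S, k)\<in>tuples D C. if restrict x S = k then 1 else 0)"

definition tuple_inner ::
  "'d set \<Rightarrow> 'v set set \<Rightarrow> ('v set \<times> ('v \<Rightarrow> 'd) \<Rightarrow> real) \<Rightarrow> ('v set \<times> ('v \<Rightarrow> 'd) \<Rightarrow> real) \<Rightarrow> real" where
  "tuple_inner D C f h = (\<Sum>t\<in>tuples D C. f t * h t)"

definition super_reparametrization ::
  "'d set \<Rightarrow> 'v set \<Rightarrow> 'v set set \<Rightarrow>
    ('v set \<times> ('v \<Rightarrow> 'd) \<Rightarrow> real) \<Rightarrow> ('v set \<times> ('v \<Rightarrow> 'd) \<Rightarrow> real) \<Rightarrow> bool" where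
  "super_reparametrization D V C f g \<longleftrightarrow>
    (\<forall>x \<in> V \<rightarrow>\<^sub>E D. tuple_inner D C f (phi D C x) \<ge> tuple_inner D C g (phi D C x))"

definition active_tuples ::
  "'d set \<Rightarrow> 'v set set \<Rightarrow> ('v set \<times> ('v \<Rightarrow> 'd) \<Rightarrow> real) \<Rightarrow> ('v set \<times> ('v \<Rightarrow> 'd)) set" where
  "active_tuples D C f = (\<Union>S\<in>C. {t \<in> scope_tuples D S. f t = Max (f ` scope_tuples D S)})"

lemma tuple_inner_phi:
  assumes "finite V" and "finite D" and "C \<subseteq> Pow V" and "x \<in> V \<rightarrow>\<^sub>E D"
  shows "tuple_inner D C f (phi D C x) = (\<Sum>S\<in>C. f (S, restrict x S))"
proof -
  have fin: "finite C" "\<And>S. S \<in> C \<Longrightarrow> finite (S \<rightarrow>\<^sub>E D)"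
    using assms by (auto intro!: finite_PiE intro: finite_subset)
  have mem: "restrict x S \<in> S \<rightarrow>\<^sub>E D" if "S \<in> C" for S
    using that assms by (auto simp: PiE_iff)
  have T: "tuples D C = Sigma C (\<lambda>S. S \<rightarrow>\<^sub>E D)"
    by (auto simp: tuples_def scope_tuples_def)
  have "tuple_inner D C f (phi D C x) =
      (\<Sum>t\<in>Sigma C (\<lambda>S. S \<rightarrow>\<^sub>E D). case t of (S, k) \<Rightarrow> if restrict x S = k then f (S, k) else 0)"
    unfolding tuple_inner_def phi_def T by (rule sum.cong) (auto simp: T)
  also have "\<dots> = (\<Sum>S\<in>C. \<Sum>k\<in>S \<rightarrow>\<^sub>E D. if restrict x S = k then f (S, k) else 0)"
    using fin by (subst sum.Sigma) auto
  also have "\<dots> = (\<Sum>S\<in>C. f (S, restrict x S))"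
    using fin mem by (intro sum.cong refl) (simp add: sum.delta)
  finally show ?thesis .
qed

end

(* Adding a constant to all weights changes no active tuple, and a large enough constant makes
   the WCSP dominate g tuple by tuple, hence a super-reparametrization of g. *)
theory Submission
  imports Defs
begin

text \<open>Only the inclusion from right to left has content. Activity compares weights within one
  scope, so replacing \<open>f\<close> by \<open>f + a\<close> preserves it
  (\<open>active_tuples_add_const\<close>). As T is finite, some \<open>a\<close> gives g \<le> f +
  a in every component, and this passes to all objectives
  (\<open>super_reparametrization_mono\<close>).\<close>

lemma finite_scope_tuples: "finite S \<Longrightarrow> finite D \<Longrightarrow> finite (scope_tuples D S)"
  by (simp add: scope_tuples_def finite_PiE)

lemma scope_tuples_nonempty: "D \<noteq> {} \<Longrightarrow> scope_tuples D S \<noteq> {}"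
  by (simp add: scope_tuples_def PiE_eq_empty_iff ex_in_conv)

lemma finite_tuples:
  assumes "finite V" and "finite D" and "C \<subseteq> Pow V"
  shows "finite (tuples D C)"
  unfolding tuples_def using assms
  by (intro finite_UN_I finite_scope_tuples) (auto intro: finite_subset)

text \<open>Activity never looks outside T, so a shifted vector may be cut back to T to become a
  member of \<open>wcsps D C\<close>.\<close>

lemma active_tuples_cong:
  assumes "\<And>t. t \<in> tuples D C \<Longrightarrow> f t = h t"
  shows "active_tuples D C f = active_tuples D C h"
proof -
  have eq: "f t = h t" if "S \<in> C" "t \<in> scope_tuples D S" for S t
    using that by (intro assms) (auto simp only: tuples_def)
  then have "f ` scope_tuples D S = h ` scope_tuples D S" if "S \<in> C" for S
    using that by (intro image_cong) auto
  then show ?thesis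
    unfolding active_tuples_def using eq by (intro SUP_cong) auto
qed

text \<open>The maximum over each finite nonempty \<open>scope_tuples D S\<close> also rises by
  \<open>a\<close>, which then cancels.\<close>

lemma active_tuples_add_const:
  assumes "finite D" and "D \<noteq> {}" and "\<And>S. S \<in> C \<Longrightarrow> finite S"
  shows "active_tuples D C (\<lambda>t. f t + a) = active_tuples D C f"
  unfolding active_tuples_def
  by (intro SUP_cong refl)
     (simp add: Max_add_commute finite_scope_tuples scope_tuples_nonempty assms)

text \<open>The entries of \<open>phi D C x\<close> are 0 or 1, hence nonnegative, so the inner
  products compare term by term.\<close>

lemma super_reparametrization_mono:
  assumes "\<And>t. t \<in> tuples D C \<Longrightarrow> g t \<le> f t"
  shows "super_reparametrization D V C f g"
  unfolding super_reparametrization_def tuple_inner_def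
  by (intro ballI sum_mono mult_right_mono assms) (auto simp: phi_def)

theorem theorem14:
  fixes D :: "'d set" and V :: "'v set" and C :: "'v set set"
    and g :: "'v set \<times> ('v \<Rightarrow> 'd) \<Rightarrow> real"
  assumes "finite V"
    and "finite D" and "D \<noteq> {}"
    and "C \<subseteq> Pow V" and "{} \<notin> C"
    and "g \<in> wcsps D C"
  shows "{active_tuples D C f | f. f \<in> wcsps D C \<and> super_reparametrization D V C f g}
       = {active_tuples D C f | f. f \<in> wcsps D C}"
proof -
  have "\<exists>h. active_tuples D C f = active_tuples D C h \<and> h \<in> wcsps D C \<and>
          super_reparametrization D V C h g" for f
  proof -
    \<comment> \<open>Each gap \<open>g t - f t\<close> is at most this sum of nonnegative terms;
      unlike a maximum, the sum is also well behaved when T is empty.\<close>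
    define a where "a = (\<Sum>t\<in>tuples D C. \<bar>g t - f t\<bar>)"
    define h where "h = restrict (\<lambda>t. f t + a) (tuples D C)"
    have "active_tuples D C h = active_tuples D C (\<lambda>t. f t + a)"
      by (rule active_tuples_cong) (simp add: h_def)
    also have "\<dots> = active_tuples D C f"
      using assms by (intro active_tuples_add_const) (blast intro: finite_subset)+
    finally have "active_tuples D C f = active_tuples D C h" ..
    moreover have "h \<in> wcsps D C"
      by (simp add: h_def wcsps_def)
    moreover have "g t \<le> h t" if "t \<in> tuples D C" for t
    proof -
      have "\<bar>g t - f t\<bar> \<le> a"
        unfolding a_def using that finite_tuples assms by (intro member_le_sum) auto
      then show ?thesis
        using that by (simp add: h_def)
    qed
    then have "super_reparametrization D V C h g"
      by (rule super_reparametrization_mono)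
    ultimately show ?thesis
      by blast
  qed
  then show ?thesis
    by blast
qed

end
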